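(* Let $S=N\times\mathbb R_+$ be endowed with the metric $d_S$ with normalisation $C_N=\frac1{\log\eta}$. There exists a constant $C>0$ such that the natural embedding $\Psi:\mathcal{SW}_N\to S$ defined by $\Psi(z_Q)=(c_Q,\eta^{\mathfrak h(Q)})$ for every $z_Q\in\mathcal{SW}_N$ is a $(1,C)$-quasi-isometry. Namely, for all vertices $z_Q,z_R\in\mathcal{SW}_N$, $$\bigl|d_S(\Psi(z_Q),\Psi(z_R))-d_{\mathcal{SW}_N}(z_Q,z_R)\bigr|\le C,$$ and $\sup_{x\in S}d_S(x,\Psi(\mathcal{SW}_N))<\infty$.
   Context: $(N,d_N,\mu_N)$ is a geodesic doubling metric measure space. $\mathbb R_+=(0,\infty)$ and, for $(x,y),(x',y')\in S=N\times\mathbb R_+$, $$d_S((x,y),(x',y'))=C_N\operatorname{arcosh}\left(1+\frac{d_N(x,x')^2+(y-y')^2}{2yy'}\right).$$ Dyadic system: fix constants $\eta>1$, $c_1,c_2>0$ and, for each $k\in\mathbb Z$, a partition $\mathscr D_k$ of $N$ into (measurable) sets called cubes at scale $k$ (cubes are regarded as labelled by their scale), such that for $\ell>k$ every $Q\in\mathscr D_k$ is contained in a unique $P\in\mathscr D_\ell$, denoted $Q^{(\ell-k)}$ (with $\widehat Q=Q^{(1)}$, $Q^{(0)}=Q$), and each $Q\in\mathscr D_k$ has a fixed center $c_Q$ with $B_N(c_Q,c_1\eta^k)\subset Q\subset B_N(c_Q,c_2\eta^k)$. Such systems exist by Christ's construction. The height of $Q\in\mathscr D_k$ is $\mathfrak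 h(Q)=k$. Graph $\mathcal{SW}_N$: fix $\lambda>\max\{\frac{\eta}{\eta-1}c_2,\,2c_2+1\}$ and for $Q\in\mathscr D_k$ put $\lambda Q=B_N(c_Q,\lambda\eta^k)$. The vertices of $\mathcal{SW}_N$ are $z_Q=(c_Q,\eta^k)$, $Q\in\mathscr D_k$, $k\in\mathbb Z$, with height $\mathfrak h(z_Q)=\mathfrak h(Q)=k$. Two distinct vertices $z_Q,z_R$ are joined by an edge iff either $R=\widehat Q$ or $Q=\widehat R$ (vertical edge), or $\mathfrak h(Q)=\mathfrak h(R)$, $Q\ne R$ and $\lambda Q\cap\lambda R\ne\emptyset$ (horizontal edge). This graph is connected; $d_{\mathcal{SW}_N}$ is its graph distance. *)

theory Defs
  imports "HOL-Analysis.Analysis"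
begin

section \<open>Geodesic doubling metric measure spaces\<close>

definition geodesic_space :: "'a::metric_space itself \<Rightarrow> bool" where
  "geodesic_space _ \<longleftrightarrow>
     (\<forall>x y::'a. \<exists>\<gamma>::real \<Rightarrow> 'a. \<gamma> 0 = x \<and> \<gamma> (dist x y) = y \<and>
        (\<forall>s\<in>{0..dist x y}. \<forall>t\<in>{0..dist x y}. dist (\<gamma> s) (\<gamma> t) = \<bar>s - t\<bar>))"

text \<open>Inclusion of the Borel sets, rather than equality, also admits completed Borel measures.\<close>

definition doubling_measure :: "'a::metric_space measure \<Rightarrow> bool" where
  "doubling_measure \<mu> \<longleftrightarrow>
     sets borel \<subseteq> sets \<mu> \<and>
     (\<forall>x r. r > 0 \<longrightarrow> 0 < emeasure \<mu> (ball x r) \<and> emeasure \<mu> (ball x r) < \<infinity>) \<and>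
     (\<exists>K::real. \<forall>x r. r > 0 \<longrightarrow>
        emeasure \<mu> (ball x (2 * r)) \<le> ennreal K * emeasure \<mu> (ball x r))"

section \<open>The space \<open>N \<times> (0,\<infinity>)\<close>\<close>

definition upper_space :: "('a \<times> real) set" where
  "upper_space = UNIV \<times> {0<..}"

definition dist_S :: "real \<Rightarrow> 'a::metric_space \<times> real \<Rightarrow> 'a \<times> real \<Rightarrow> real" where
  "dist_S C p q =
     C * arcosh (1 + ((dist (fst p) (fst q))\<^sup>2 + (snd p - snd q)\<^sup>2) / (2 * snd p * snd q))"

section \<open>Dyadic systems\<close>

text \<open>
  Cubes are labelled by their scale: the same set may belong to \<open>D k\<close> for several \<open>k\<close>, and a
  cube is a pair of an integer \<open>k\<close> and a set \<open>Q \<in> D k\<close>. In particular its centre \<open>cen k Q\<close> may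
  depend on \<open>k\<close>.
\<close>

definition dyadic_system ::
  "'a::metric_space measure \<Rightarrow> real \<Rightarrow> real \<Rightarrow> real \<Rightarrow>
   (int \<Rightarrow> 'a set set) \<Rightarrow> (int \<Rightarrow> 'a set \<Rightarrow> 'a) \<Rightarrow> bool" where
  "dyadic_system \<mu> \<eta> c1 c2 D cen \<longleftrightarrow>
     \<eta> > 1 \<and> c1 > 0 \<and> c2 > 0 \<and>
     (\<forall>k. partition_on UNIV (D k)) \<and>
     (\<forall>k. D k \<subseteq> sets \<mu>) \<and>
     (\<forall>k l. k < l \<longrightarrow> (\<forall>Q\<in>D k. \<exists>!P. P \<in> D l \<and> Q \<subseteq> P)) \<and>
     (\<forall>k. \<forall>Q\<in>D k. ball (cen k Q) (c1 * \<eta> powi k) \<subseteq> Q \<and> Q \<subseteq> ball (cen k Q) (c2 * \<eta> powi k))"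

definition parent :: "(int \<Rightarrow> 'a set set) \<Rightarrow> int \<Rightarrow> 'a set \<Rightarrow> 'a set" where
  "parent D k Q = (THE P. P \<in> D (k + 1) \<and> Q \<subseteq> P)"

section \<open>The graph\<close>

definition vertex :: "real \<Rightarrow> (int \<Rightarrow> 'a set \<Rightarrow> 'a) \<Rightarrow> int \<Rightarrow> 'a set \<Rightarrow> 'a \<times> real" where
  "vertex \<eta> cen k Q = (cen k Q, \<eta> powi k)"

definition vertices ::
  "real \<Rightarrow> (int \<Rightarrow> 'a set set) \<Rightarrow> (int \<Rightarrow> 'a set \<Rightarrow> 'a) \<Rightarrow> ('a \<times> real) set" where
  "vertices \<eta> D cen = {vertex \<eta> cen k Q |k Q. Q \<in> D k}"

definition height ::
  "real \<Rightarrow> (int \<Rightarrow> 'a set set) \<Rightarrow> (int \<Rightarrow> 'a set \<Rightarrow> 'a) \<Rightarrow> 'a \<times> real \<Rightarrow> int" where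
  "height \<eta> D cen v = (THE k. \<exists>Q\<in>D k. v = vertex \<eta> cen k Q)"

definition dilated :: "real \<Rightarrow> real \<Rightarrow> (int \<Rightarrow> 'a::metric_space set \<Rightarrow> 'a) \<Rightarrow> int \<Rightarrow> 'a set \<Rightarrow> 'a set" where
  "dilated \<eta> lam cen k Q = ball (cen k Q) (lam * \<eta> powi k)"

text \<open>The edges form a symmetric relation.\<close>

definition edges ::
  "real \<Rightarrow> real \<Rightarrow> (int \<Rightarrow> 'a::metric_space set set) \<Rightarrow> (int \<Rightarrow> 'a set \<Rightarrow> 'a) \<Rightarrow>
   (('a \<times> real) \<times> ('a \<times> real)) set" where
  "edges \<eta> lam D cen =
     {(vertex \<eta> cen k Q, vertex \<eta> cen l R) |k Q l R.
        Q \<in> D k \<and> R \<in> D l \<and> vertex \<eta> cen k Q \<noteq> vertex \<eta> cen l R \<and>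
        ((l = k + 1 \<and> R = parent D k Q) \<or>
         (k = l + 1 \<and> Q = parent D l R) \<or>
         (k = l \<and> Q \<noteq> R \<and> dilated \<eta> lam cen k Q \<inter> dilated \<eta> lam cen l R \<noteq> {}))}"

text \<open>
  The length of a shortest walk. The value is meaningful only for points joined by a walk; any two
  vertices of the graph at hand are, see \<open>connected_graph\<close> below.
\<close>

definition graph_dist :: "('v \<times> 'v) set \<Rightarrow> 'v \<Rightarrow> 'v \<Rightarrow> nat" where
  "graph_dist E u v = (LEAST n. (u, v) \<in> E ^^ n)"

text \<open>The vertices are themselves points of \<open>N \<times> (0,\<infinity>)\<close>, and the embedding is the inclusion.\<close>

definition embedding ::
  "real \<Rightarrow> (int \<Rightarrow> 'a set set) \<Rightarrow> (int \<Rightarrow> 'a set \<Rightarrow> 'a) \<Rightarrow> 'a \<times> real \<Rightarrow> 'a \<times> real" where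
  "embedding \<eta> D cen v = (fst v, \<eta> powi height \<eta> D cen v)"

section \<open>The height is well defined and the graph is connected\<close>

lemma height_vertex:
  assumes "\<eta> > 1" "Q \<in> D k"
  shows "height \<eta> D cen (vertex \<eta> cen k Q) = k"
proof -
  have "\<And>l. \<eta> powi k = \<eta> powi l \<Longrightarrow> l = k"
    using assms(1) by (metis linorder_neqE order_less_irrefl power_int_strict_increasing)
  then show ?thesis
    unfolding height_def vertex_def using assms(2) by (intro the_equality) auto
qed

lemma connected_graph:
  fixes D :: "int \<Rightarrow> 'a::metric_space set set"
  assumes D: "dyadic_system \<mu> \<eta> c1 c2 D cen" and lam: "lam > 2 * c2 + 1"
    and u: "u \<in> vertices \<eta> D cen" and v: "v \<in> vertices \<eta> D cen"
  shows "(u, v) \<in> (edges \<eta> lam D cen)\<^sup>*"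
proof -
  let ?E = "edges \<eta> lam D cen" and ?z = "vertex \<eta> cen"
  have eta: "\<eta> > 1" and c1: "c1 > 0" and c2: "c2 > 0"
    and nest: "\<And>k l Q. k < l \<Longrightarrow> Q \<in> D k \<Longrightarrow> \<exists>!P. P \<in> D l \<and> Q \<subseteq> P"
    and part: "\<And>k. partition_on UNIV (D k)"
    and inner: "\<And>k Q. Q \<in> D k \<Longrightarrow> ball (cen k Q) (c1 * \<eta> powi k) \<subseteq> Q"
    and outer: "\<And>k Q. Q \<in> D k \<Longrightarrow> Q \<subseteq> ball (cen k Q) (c2 * \<eta> powi k)"
    using D by (simp_all add: dyadic_system_def)
  have pos: "\<eta> powi k > 0" for k
    using eta by simp
  have cenQ: "cen k Q \<in> Q" if "Q \<in> D k" for k Q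
    using inner[OF that] c1 pos[of k] by auto
  have sym: "sym ?E"
  proof (rule symI)
    fix a b assume "(a, b) \<in> ?E"
    then obtain k Q l R where "a = ?z k Q" "b = ?z l R" "Q \<in> D k" "R \<in> D l" "?z l R \<noteq> ?z k Q"
      "(k = l + 1 \<and> Q = parent D l R) \<or> (l = k + 1 \<and> R = parent D k Q) \<or>
       (l = k \<and> R \<noteq> Q \<and> dilated \<eta> lam cen l R \<inter> dilated \<eta> lam cen k Q \<noteq> {})"
      unfolding edges_def by fastforce
    then show "(b, a) \<in> ?E"
      unfolding edges_def by blast
  qed
  have par: "parent D k Q \<in> D (k + 1) \<and> Q \<subseteq> parent D k Q" if "Q \<in> D k" for k Q
    unfolding parent_def by (rule theI'[OF nest[OF _ that]]) simp
  have vert: "(?z k Q, ?z (k + 1) (parent D k Q)) \<in> ?E" if "Q \<in> D k" for k Q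
  proof -
    have "\<eta> powi k \<noteq> \<eta> powi (k + 1)"
      using eta by (metis less_add_one order_less_irrefl power_int_strict_increasing)
    then show ?thesis
      unfolding edges_def using par[OF that] that by (auto simp: vertex_def)
  qed
  have up: "\<exists>P. P \<in> D (k + int n) \<and> Q \<subseteq> P \<and> (?z k Q, ?z (k + int n) P) \<in> ?E\<^sup>*"
    if "Q \<in> D k" for k n Q
  proof (induction n)
    case 0
    then show ?case using that by auto
  next
    case (Suc n)
    then obtain P where P: "P \<in> D (k + int n)" "Q \<subseteq> P" "(?z k Q, ?z (k + int n) P) \<in> ?E\<^sup>*"
      by blast
    have "k + int (Suc n) = k + int n + 1" by simp
    then show ?case
      using par[OF P(1)] vert[OF P(1)] P(2,3) by (metis order_trans rtrancl.rtrancl_into_rtrancl)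
  qed
  obtain k Q where Q: "Q \<in> D k" "u = ?z k Q"
    using u unfolding vertices_def by blast
  obtain l R where R: "R \<in> D l" "v = ?z l R"
    using v unfolding vertices_def by blast
  obtain j where j: "dist (cen k Q) (cen l R) < \<eta> ^ j"
    using eta real_arch_pow by blast
  define h where "h = max (max k l) (int j)"
  have "int j \<le> h" "k \<le> h" "l \<le> h" unfolding h_def by auto
  then have "\<eta> ^ j \<le> \<eta> powi h"
    using power_int_increasing[of "int j" h \<eta>] eta by simp
  with j have dh: "dist (cen k Q) (cen l R) < \<eta> powi h" by linarith
  obtain P where P: "P \<in> D h" "Q \<subseteq> P" "(u, ?z h P) \<in> ?E\<^sup>*"
    using up[OF Q(1), of "nat (h - k)"] \<open>k \<le> h\<close> Q(2) by auto
  obtain T where T: "T \<in> D h" "R \<subseteq> T" "(v, ?z h T) \<in> ?E\<^sup>*"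
    using up[OF R(1), of "nat (h - l)"] \<open>l \<le> h\<close> R(2) by auto
  have "dist (cen h P) (cen k Q) < c2 * \<eta> powi h"
    using cenQ[OF Q(1)] P(2) outer[OF P(1)] by auto
  moreover have "dist (cen h T) (cen l R) < c2 * \<eta> powi h"
    using cenQ[OF R(1)] T(2) outer[OF T(1)] by auto
  moreover have "dist (cen h P) (cen h T) \<le>
      dist (cen h P) (cen k Q) + dist (cen k Q) (cen l R) + dist (cen h T) (cen l R)"
    using dist_triangle[of "cen h P" "cen h T" "cen k Q"]
      dist_triangle[of "cen k Q" "cen h T" "cen l R"] dist_commute[of "cen h T" "cen l R"]
    by linarith
  ultimately have "dist (cen h P) (cen h T) < (2 * c2 + 1) * \<eta> powi h"
    using dh by (simp add: algebra_simps)
  also have "\<dots> < lam * \<eta> powi h"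
    using lam pos[of h] by simp
  finally have "cen h T \<in> dilated \<eta> lam cen h P \<inter> dilated \<eta> lam cen h T"
    using lam c2 pos[of h] unfolding dilated_def by simp
  then have meet: "dilated \<eta> lam cen h P \<inter> dilated \<eta> lam cen h T \<noteq> {}" by blast
  have "(?z h P, ?z h T) \<in> ?E\<^sup>*"
  proof (cases "P = T")
    case False
    then have "P \<inter> T = {}"
      using part[of h] P(1) T(1) unfolding partition_on_def disjoint_def by blast
    then have "?z h P \<noteq> ?z h T"
      using cenQ[OF P(1)] cenQ[OF T(1)] by (auto simp: vertex_def)
    then have "(?z h P, ?z h T) \<in> ?E"
      unfolding edges_def using False P(1) T(1) meet by blast
    then show ?thesis by blast
  qed simp
  moreover have "(?z h T, v) \<in> ?E\<^sup>*"
    using T(3) sym by (meson sym_rtrancl symD)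
  ultimately show ?thesis
    using P(3) by (meson rtrancl_trans)
qed

end

theory Submission
  imports Defs
begin

text \<open>
  Write \<open>y = \<eta>\<^sup>k\<close>, \<open>y' = \<eta>\<^sup>l\<close> for the heights of two vertices and \<open>d\<close> for the distance of their
  centres. Up to an additive constant, \<open>dist_S\<close> is the logarithm to base \<open>\<eta>\<close> of
  \<open>(d\<^sup>2 + y\<^sup>2 + y'\<^sup>2) / (y y')\<close>. Climbing to the first level \<open>h\<close> with \<open>\<eta>\<^sup>h \<ge> max d y y'\<close>, crossing by at
  most one horizontal edge and descending takes at most \<open>2 h - k - l + 1\<close> steps, which gives one
  inequality. Conversely an edge issuing from height \<open>y\<close> displaces the centre by \<open>O(y)\<close>, so a walk of
  length \<open>n\<close>, whose heights grow and shrink by factors of at most \<open>\<eta>\<close>, satisfies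
  \<open>d \<le> A sqrt (y y' \<eta>\<^sup>n)\<close>, which gives the other.
\<close>

section \<open>Logarithmic bounds for \<open>dist_S\<close>\<close>

lemma arcosh_le_ln:
  fixes x :: real
  assumes "x \<ge> 1"
  shows "arcosh x \<le> ln (2 * x)"
proof -
  have "sqrt (x\<^sup>2 - 1) \<le> sqrt (x\<^sup>2)"
    by (rule real_sqrt_le_mono) simp
  then have "sqrt (x\<^sup>2 - 1) \<le> x"
    using assms by simp
  moreover have "0 \<le> sqrt (x\<^sup>2 - 1)"
    using assms by simp
  ultimately have "ln (x + sqrt (x\<^sup>2 - 1)) \<le> ln (2 * x)"
    using assms by (intro ln_mono) linarith+
  then show ?thesis
    using assms by (simp add: arcosh_real_def)
qed

lemma ln_le_arcosh:
  fixes x :: real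
  assumes "x \<ge> 1"
  shows "ln x \<le> arcosh x"
proof -
  have "0 \<le> sqrt (x\<^sup>2 - 1)"
    using assms by simp
  then have "ln x \<le> ln (x + sqrt (x\<^sup>2 - 1))"
    using assms by (intro ln_mono) auto
  then show ?thesis
    using assms by (simp add: arcosh_real_def)
qed

text \<open>Expanding the square of the height difference cancels the leading 1, so twice the
  argument of \<open>arcosh\<close> is exactly the quotient controlled by \<open>le\<close>. The
  factor 2 in \<open>arcosh_le_ln\<close> then matches, and no extra constant appears.\<close>

lemma dist_S_upper:
  fixes p q :: "'a::metric_space \<times> real"
  assumes "C > 0" "snd p > 0" "snd q > 0" "K > 0"
    and le: "(dist (fst p) (fst q))\<^sup>2 + (snd p)\<^sup>2 + (snd q)\<^sup>2 \<le> K * (snd p * snd q)"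
  shows "dist_S C p q \<le> C * ln K"
proof -
  define X where "X = 1 + ((dist (fst p) (fst q))\<^sup>2 + (snd p - snd q)\<^sup>2) / (2 * snd p * snd q)"
  have "X \<ge> 1"
    unfolding X_def using assms by simp
  moreover have "2 * X = ((dist (fst p) (fst q))\<^sup>2 + (snd p)\<^sup>2 + (snd q)\<^sup>2) / (snd p * snd q)"
    unfolding X_def using assms(2,3) by (simp add: field_simps power2_eq_square)
  then have "2 * X \<le> K"
    using assms by (simp add: divide_le_eq)
  ultimately have "arcosh X \<le> ln K"
    using arcosh_le_ln[of X] assms(4) by (smt (verit) ln_le_cancel_iff)
  then show ?thesis
    using assms(1) by (simp add: dist_S_def X_def[symmetric])
qed

text \<open>The loss of \<open>ln 2\<close> comes from bounding \<open>arcosh X\<close> below by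
  \<open>ln X\<close> while \<open>K\<close> is only known to be at most
  \<open>2 * X\<close>.\<close>

lemma dist_S_lower:
  fixes p q :: "'a::metric_space \<times> real"
  assumes "C > 0" "snd p > 0" "snd q > 0" "K > 0"
    and le: "K * (snd p * snd q) \<le> (dist (fst p) (fst q))\<^sup>2 + (snd p)\<^sup>2 + (snd q)\<^sup>2"
  shows "C * (ln K - ln 2) \<le> dist_S C p q"
proof -
  define X where "X = 1 + ((dist (fst p) (fst q))\<^sup>2 + (snd p - snd q)\<^sup>2) / (2 * snd p * snd q)"
  have X: "X \<ge> 1"
    unfolding X_def using assms by simp
  have "2 * X = ((dist (fst p) (fst q))\<^sup>2 + (snd p)\<^sup>2 + (snd q)\<^sup>2) / (snd p * snd q)"
    unfolding X_def using assms(2,3) by (simp add: field_simps power2_eq_square)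
  then have "K \<le> 2 * X"
    using assms by (simp add: le_divide_eq)
  then have "ln K \<le> ln 2 + ln X"
    using X assms(4) by (metis ln_le_cancel_iff ln_mult_pos less_le_trans zero_less_numeral zero_less_one)
  then have "ln K - ln 2 \<le> arcosh X"
    using ln_le_arcosh[OF X] by linarith
  then show ?thesis
    using assms(1) by (simp add: dist_S_def X_def[symmetric])
qed

section \<open>Reversal of walks and growth along walks\<close>

lemma sym_edges: "sym (edges \<eta> lam D cen)"
proof (rule symI)
  fix a b assume "(a, b) \<in> edges \<eta> lam D cen"
  then obtain k Q l R where "a = vertex \<eta> cen k Q" "b = vertex \<eta> cen l R" "Q \<in> D k" "R \<in> D l"
    "vertex \<eta> cen l R \<noteq> vertex \<eta> cen k Q"
    "(k = l + 1 \<and> Q = parent D l R) \<or> (l = k + 1 \<and> R = parent D k Q) \<or>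
     (l = k \<and> R \<noteq> Q \<and> dilated \<eta> lam cen l R \<inter> dilated \<eta> lam cen k Q \<noteq> {})"
    unfolding edges_def by fastforce
  then show "(b, a) \<in> edges \<eta> lam D cen"
    unfolding edges_def by blast
qed

lemma sym_relpow:
  assumes "sym R" "(a, b) \<in> R ^^ n"
  shows "(b, a) \<in> R ^^ n"
  using assms(2)
proof (induction n arbitrary: b)
  case (Suc n)
  then obtain c where "(a, c) \<in> R ^^ n" "(c, b) \<in> R"
    by auto
  then show ?case
    using Suc.IH assms(1) by (meson relpow_Suc_I2 symD)
qed simp

lemma relpow_growth:
  assumes "\<And>a b. (a, b) \<in> E \<Longrightarrow> f b \<le> r * f a" "r \<ge> 0" "(a, b) \<in> E ^^ n"
  shows "f b \<le> r ^ n * (f a :: real)"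
  using assms(3)
proof (induction n arbitrary: b)
  case (Suc n)
  then obtain c where c: "(a, c) \<in> E ^^ n" "(c, b) \<in> E"
    by auto
  have "f b \<le> r * f c"
    using assms(1) c(2) by blast
  also have "\<dots> \<le> r * (r ^ n * f a)"
    using Suc.IH[OF c(1)] assms(2) by (rule mult_left_mono)
  finally show ?case
    by (simp add: mult.assoc)
qed auto

section \<open>Cubes, centres and parents\<close>

text \<open>A centre belongs to its cube because the inner ball has positive radius. Nesting with
  \<open>l = k + 1\<close> makes the description defining \<open>parent\<close> denote the expected
  cube.\<close>

lemma dyadic_systemD:
  assumes "dyadic_system \<mu> \<eta> c1 c2 D cen"
  shows "\<eta> > 1" "c2 > 0" "partition_on UNIV (D k)"
    and "Q \<in> D k \<Longrightarrow> cen k Q \<in> Q"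
    and "Q \<in> D k \<Longrightarrow> x \<in> Q \<Longrightarrow> dist (cen k Q) x < c2 * \<eta> powi k"
    and "Q \<in> D k \<Longrightarrow> parent D k Q \<in> D (k + 1)"
    and "Q \<in> D k \<Longrightarrow> Q \<subseteq> parent D k Q"
proof -
  have eta: "\<eta> > 1" and c1: "c1 > 0" and c2: "c2 > 0"
    and part: "\<forall>k. partition_on UNIV (D k)"
    and nest: "\<forall>k l. k < l \<longrightarrow> (\<forall>Q\<in>D k. \<exists>!P. P \<in> D l \<and> Q \<subseteq> P)"
    and balls: "\<forall>k. \<forall>Q\<in>D k. ball (cen k Q) (c1 * \<eta> powi k) \<subseteq> Q \<and>
      Q \<subseteq> ball (cen k Q) (c2 * \<eta> powi k)"
    using assms unfolding dyadic_system_def by - (elim conjE, assumption)+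
  show "\<eta> > 1" "c2 > 0" "partition_on UNIV (D k)"
    using eta c2 part by simp_all
  show "cen k Q \<in> Q" if "Q \<in> D k"
  proof -
    have "cen k Q \<in> ball (cen k Q) (c1 * \<eta> powi k)"
      using eta c1 by simp
    then show ?thesis
      using balls that by blast
  qed
  show "dist (cen k Q) x < c2 * \<eta> powi k" if "Q \<in> D k" "x \<in> Q"
  proof -
    have "x \<in> ball (cen k Q) (c2 * \<eta> powi k)"
      using balls that by blast
    then show ?thesis
      by simp
  qed
  have parent: "parent D k Q \<in> D (k + 1) \<and> Q \<subseteq> parent D k Q" if "Q \<in> D k"
    unfolding parent_def by (rule theI', rule nest[rule_format, OF _ that]) simp
  show "Q \<in> D k \<Longrightarrow> parent D k Q \<in> D (k + 1)"
    by (rule parent[THEN conjunct1])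
  show "Q \<in> D k \<Longrightarrow> Q \<subseteq> parent D k Q"
    by (rule parent[THEN conjunct2])
qed

section \<open>Heights and centres along a walk\<close>

text \<open>On a vertical edge the child's centre lies in the parent cube, hence within
  \<open>c2\<close> times the parent's height, which is \<open>\<eta> * snd u\<close> when climbing.
  On a horizontal edge the dilated balls share a point, which costs at most twice their radius. The
  coefficient \<open>2 * lam * \<eta>\<close> covers all cases.\<close>

lemma edge_step:
  assumes D: "dyadic_system \<mu> \<eta> c1 c2 D cen" and lam: "lam > c2"
    and e: "(u, v) \<in> edges \<eta> lam D cen"
  shows "snd u > 0"
    and "snd v = \<eta> * snd u \<or> snd v = snd u \<or> snd u = \<eta> * snd v"
    and "dist (fst u) (fst v) \<le> 2 * lam * \<eta> * snd u"
proof -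
  have eta: "\<eta> > 1" and c2: "c2 > 0"
    by (fact dyadic_systemD[OF D])+
  obtain k Q l R where uv: "u = vertex \<eta> cen k Q" "v = vertex \<eta> cen l R" "Q \<in> D k" "R \<in> D l"
    and cases: "(l = k + 1 \<and> R = parent D k Q) \<or> (k = l + 1 \<and> Q = parent D l R) \<or>
        (k = l \<and> dilated \<eta> lam cen k Q \<inter> dilated \<eta> lam cen l R \<noteq> {})"
    using e unfolding edges_def by blast
  have suc: "\<eta> powi (j + 1) = \<eta> * \<eta> powi j" for j
    using eta by (simp add: power_int_add)
  have bound: "c2 * \<eta> * \<eta> powi k \<le> 2 * lam * \<eta> * \<eta> powi k"
    using eta lam c2 by (intro mult_right_mono) auto
  have bound1: "\<eta> powi k \<le> \<eta> * \<eta> powi k"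
    using eta by simp
  show pos: "snd u > 0"
    using eta uv by (simp add: vertex_def)
  have "(snd v = \<eta> * snd u \<or> snd v = snd u \<or> snd u = \<eta> * snd v) \<and>
      dist (fst u) (fst v) \<le> 2 * lam * \<eta> * snd u"
    using cases
  proof (elim disjE conjE)
    assume "l = k + 1" "R = parent D k Q"
    moreover from this have "dist (cen l R) (cen k Q) < c2 * \<eta> powi l"
      using dyadic_systemD(4,7)[OF D uv(3)] dyadic_systemD(5)[OF D uv(4)] by blast
    ultimately show ?thesis
      using bound by (simp add: uv vertex_def suc dist_commute mult.assoc)
  next
    assume "k = l + 1" "Q = parent D l R"
    moreover from this have "dist (cen k Q) (cen l R) < c2 * \<eta> powi k"
      using dyadic_systemD(4,7)[OF D uv(4)] dyadic_systemD(5)[OF D uv(3)] by blast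
    moreover have "c2 * \<eta> powi k \<le> c2 * \<eta> * \<eta> powi k"
      using bound1 c2 by simp
    ultimately show ?thesis
      using bound by (simp add: uv vertex_def suc)
  next
    assume "k = l" and ne: "dilated \<eta> lam cen k Q \<inter> dilated \<eta> lam cen l R \<noteq> {}"
    then obtain x where "dist (cen k Q) x < lam * \<eta> powi k" "dist (cen l R) x < lam * \<eta> powi k"
      unfolding dilated_def by auto
    then have "dist (cen k Q) (cen l R) < 2 * lam * \<eta> powi k"
      using dist_triangle2[of "cen k Q" "cen l R" x] by linarith
    also have "\<dots> \<le> 2 * lam * (\<eta> * \<eta> powi k)"
      using bound1 lam c2 by (intro mult_left_mono) auto
    finally show ?thesis
      using \<open>k = l\<close> by (simp add: uv vertex_def mult.assoc)
  qed
  then show "snd v = \<eta> * snd u \<or> snd v = snd u \<or> snd u = \<eta> * snd v"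
    and "dist (fst u) (fst v) \<le> 2 * lam * \<eta> * snd u"
    by auto
qed

lemma walk_height_le:
  assumes D: "dyadic_system \<mu> \<eta> c1 c2 D cen" and lam: "lam > c2"
    and walk: "(u, v) \<in> edges \<eta> lam D cen ^^ n"
  shows "snd v \<le> \<eta> ^ n * snd u" "snd u \<le> \<eta> ^ n * snd v"
proof -
  have eta: "\<eta> > 1"
    by (fact dyadic_systemD[OF D])
  have *: "snd b \<le> \<eta> * snd a" if ab: "(a, b) \<in> edges \<eta> lam D cen" for a b
  proof -
    \<comment> \<open>\<open>edge_step\<close> gives positivity only at the first endpoint; the
      reversed edge supplies it for \<open>b\<close>.\<close>
    have ba: "(b, a) \<in> edges \<eta> lam D cen"
      by (rule symD[OF sym_edges ab])
    have "snd b \<le> \<eta> * snd b" "\<eta> * snd b \<le> \<eta> * (\<eta> * snd b)"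
      using eta edge_step(1)[OF D lam ba] by simp_all
    then show ?thesis
      using edge_step(2)[OF D lam ab] by (elim disjE) simp_all
  qed
  have growth: "snd b \<le> \<eta> ^ n * snd a" if "(a, b) \<in> edges \<eta> lam D cen ^^ n" for a b
    using relpow_growth[where f = snd and r = \<eta>, OF * _ that] eta by simp
  show "snd v \<le> \<eta> ^ n * snd u" "snd u \<le> \<eta> ^ n * snd v"
    by (fact growth[OF walk] growth[OF sym_relpow[OF sym_edges walk]])+
qed

text \<open>
  The term \<open>- B * snd u\<close> makes the induction go through: when the first edge goes up, \<open>snd u\<close> grows
  while \<open>snd u * snd v * \<eta> ^ n\<close> is the same before and after the step.
\<close>

lemma walk_displacement:
  assumes D: "dyadic_system \<mu> \<eta> c1 c2 D cen" and lam: "lam > c2"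
    and K: "K = 2 * lam * \<eta>" and B: "B = K / (\<eta> - 1)" and A: "A = B + K / (1 - 1 / sqrt \<eta>)"
    and "(u, v) \<in> edges \<eta> lam D cen ^^ n" and "snd v > 0"
  shows "dist (fst u) (fst v) \<le> A * sqrt (snd u * snd v * \<eta> ^ n) - B * snd u"
  using assms(6)
proof (induction n arbitrary: u)
  have eta: "\<eta> > 1" and c2: "c2 > 0"
    by (fact dyadic_systemD[OF D])+
  have s: "sqrt \<eta> > 1" "sqrt \<eta> < \<eta>"
    using eta real_less_lsqrt[of \<eta> \<eta>] by (simp_all add: power2_eq_square)
  have Kpos: "K > 0"
    using K eta lam c2 by simp
  have Bpos: "B > 0"
    using B Kpos eta by simp
  \<comment> \<open>\<open>B\<close> is tuned to a first edge going up, where it cancels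
    \<open>K\<close> exactly. The excess \<open>A - B\<close> is tuned to a horizontal first edge,
    which shrinks the square root by the factor \<open>sqrt \<eta>\<close>.\<close>
  have Ks: "(A - B) * (1 - 1 / sqrt \<eta>) = K"
    using A s by simp
  have AB: "A > B"
    using A Kpos s by simp
  {
    \<comment> \<open>For the empty walk the right-hand side is \<open>(A - B) * snd v\<close>,
      which is nonnegative.\<close>
    case 0
    then show ?case
      using AB \<open>snd v > 0\<close> by simp
  next
    case (Suc n)
    define \<phi> where "\<phi> = sqrt (snd u * snd v * \<eta> ^ Suc n)"
    obtain w where w: "(u, w) \<in> edges \<eta> lam D cen" "(w, v) \<in> edges \<eta> lam D cen ^^ n"
      using Suc.prems by (meson relpow_Suc_D2)
    note step = edge_step[OF D lam w(1)]
    have IH: "dist (fst w) (fst v) \<le> A * sqrt (snd w * snd v * \<eta> ^ n) - B * snd w"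
      by (rule Suc.IH[OF w(2)])
    \<comment> \<open>The whole walk ends at \<open>v\<close>, so \<open>snd u\<close> is at most
      \<open>\<eta> ^ Suc n * snd v\<close>. This lets multiples of \<open>snd u\<close> be absorbed
      by multiples of \<open>\<phi>\<close>.\<close>
    have "snd u * snd u \<le> snd u * snd v * \<eta> ^ Suc n"
      using walk_height_le(2)[OF D lam Suc.prems] step(1)
      by (simp add: mult.commute mult.left_commute)
    then have phi: "snd u \<le> \<phi>"
      unfolding \<phi>_def using step(1) by (simp add: power2_eq_square real_le_rsqrt)
    have "dist (fst u) (fst v) \<le> K * snd u + (A * sqrt (snd w * snd v * \<eta> ^ n) - B * snd w)"
      using dist_triangle[of "fst u" "fst v" "fst w"] step(3) IH
      unfolding K by linarith
    also have "\<dots> \<le> A * \<phi> - B * snd u"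
      using step(2)
    proof (elim disjE)
      \<comment> \<open>Up: the gain in height offsets the lost factor \<open>\<eta>\<close>, so
        only the linear term can pay for the displacement.\<close>
      assume h: "snd w = \<eta> * snd u"
      then have "sqrt (snd w * snd v * \<eta> ^ n) = \<phi>"
        unfolding \<phi>_def by (simp add: mult_ac)
      moreover have "K * snd u = B * (\<eta> - 1) * snd u"
        using B eta by simp
      ultimately show ?thesis
        using h by (simp add: algebra_simps)
    next
      \<comment> \<open>Horizontal: the linear term is unchanged, and the decrease of
        \<open>\<phi>\<close> to \<open>\<phi> / sqrt \<eta>\<close> pays.\<close>
      assume h: "snd w = snd u"
      have "sqrt (snd w * snd v * \<eta> ^ n) = \<phi> / sqrt \<eta>"
        unfolding \<phi>_def h real_sqrt_divide[symmetric] using eta by simp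
      moreover have "K * snd u \<le> (A * (1 - 1 / sqrt \<eta>)) * \<phi>"
      proof (rule mult_mono[OF _ phi])
        show "K \<le> A * (1 - 1 / sqrt \<eta>)"
          unfolding Ks[symmetric] using Bpos s by (intro mult_right_mono) auto
        show "0 \<le> A * (1 - 1 / sqrt \<eta>)"
          using AB Bpos s by simp
      qed (use step(1) in simp)
      ultimately show ?thesis
        using h by (simp add: algebra_simps)
    next
      \<comment> \<open>Down: \<open>\<phi>\<close> drops to \<open>\<phi> / \<eta>\<close>. This
        drop must pay for the displacement and also for the weakening of the linear term by
        \<open>B * (1 - 1 / \<eta>) * snd u\<close>.\<close>
      assume h: "snd u = \<eta> * snd w"
      then have w': "snd w = snd u / \<eta>"
        using eta by simp
      have "sqrt (snd w * snd v * \<eta> ^ n) = sqrt (snd u * snd v * \<eta> ^ Suc n / \<eta>\<^sup>2)"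
        using h eta by (simp add: power2_eq_square)
      also have "\<dots> = \<phi> / \<eta>"
        unfolding \<phi>_def real_sqrt_divide using eta by simp
      finally have sq: "sqrt (snd w * snd v * \<eta> ^ n) = \<phi> / \<eta>" .
      have "(A - B) * (1 - 1 / sqrt \<eta>) \<le> (A - B) * (1 - 1 / \<eta>)"
        using AB s eta by (intro mult_left_mono) (auto simp: field_simps)
      then have "K \<le> A * (1 - 1 / \<eta>) - B * (1 - 1 / \<eta>)"
        unfolding Ks by (simp only: left_diff_distrib[of A B])
      then have "K + B * (1 - 1 / \<eta>) \<le> A * (1 - 1 / \<eta>)"
        by linarith
      then have "(K + B * (1 - 1 / \<eta>)) * snd u \<le> (A * (1 - 1 / \<eta>)) * \<phi>"
        using phi step(1) AB Bpos eta by (intro mult_mono) auto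
      then show ?thesis
        unfolding sq unfolding w' by (simp add: algebra_simps)
    qed
    finally show ?case
      unfolding \<phi>_def .
  }
qed

section \<open>Construction of short walks\<close>

text \<open>Passing to the parent climbs one level per edge. The inclusion of cubes is carried along
  so that the original centre can be located inside the ancestor.\<close>

lemma vertical_walk:
  assumes D: "dyadic_system \<mu> \<eta> c1 c2 D cen" and "Q \<in> D k"
  shows "\<exists>P. P \<in> D (k + int n) \<and> Q \<subseteq> P \<and>
    (vertex \<eta> cen k Q, vertex \<eta> cen (k + int n) P) \<in> edges \<eta> lam D cen ^^ n"
proof (induction n)
  case 0
  then show ?case
    using assms by auto
next
  case (Suc n)
  then obtain P where P: "P \<in> D (k + int n)" "Q \<subseteq> P"
    "(vertex \<eta> cen k Q, vertex \<eta> cen (k + int n) P) \<in> edges \<eta> lam D cen ^^ n"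
    by blast
  \<comment> \<open>A cube may coincide with its parent as a set and share its centre; the differing
    heights still make the vertices distinct.\<close>
  have "\<eta> powi (k + int n) \<noteq> \<eta> powi (k + int n + 1)"
    using dyadic_systemD(1)[OF D]
    by (metis less_add_one order_less_irrefl power_int_strict_increasing)
  then have "(vertex \<eta> cen (k + int n) P, vertex \<eta> cen (k + int n + 1) (parent D (k + int n) P))
      \<in> edges \<eta> lam D cen"
    unfolding edges_def using P(1) dyadic_systemD(6)[OF D P(1)] by (auto simp: vertex_def)
  then have "(vertex \<eta> cen k Q, vertex \<eta> cen (k + int n + 1) (parent D (k + int n) P))
      \<in> edges \<eta> lam D cen ^^ Suc n"
    by (rule relpow_Suc_I[OF P(3)])
  moreover have "k + int (Suc n) = k + int n + 1"
    by simp
  ultimately show ?case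
    using P(2) dyadic_systemD(6,7)[OF D P(1)]
    by (intro exI[of _ "parent D (k + int n) P"]) (simp only:, blast)
qed

text \<open>Passing to the ancestors at level \<open>h\<close> moves each centre by less than
  \<open>c2 * \<eta> powi h\<close>, so the two new centres are less than
  \<open>(2 * c2 + 1) * \<eta> powi h\<close> apart. The choice of \<open>lam\<close> makes the
  ancestors equal or adjacent.\<close>

lemma walk_over_top:
  assumes D: "dyadic_system \<mu> \<eta> c1 c2 D cen" and lam: "lam > 2 * c2 + 1"
    and Q: "Q \<in> D k" and R: "R \<in> D l" and h: "k \<le> h" "l \<le> h"
    and d: "dist (cen k Q) (cen l R) \<le> \<eta> powi h"
  shows "\<exists>n. int n \<le> 2 * h - k - l + 1 \<and>
    (vertex \<eta> cen k Q, vertex \<eta> cen l R) \<in> edges \<eta> lam D cen ^^ n"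
proof -
  let ?E = "edges \<eta> lam D cen" and ?z = "vertex \<eta> cen"
  have pos: "\<eta> powi h > 0" and c2: "c2 > 0"
    using dyadic_systemD(1,2)[OF D] by simp_all
  obtain P where P: "P \<in> D h" "Q \<subseteq> P" "(?z k Q, ?z h P) \<in> ?E ^^ nat (h - k)"
    using vertical_walk[OF D Q, of "nat (h - k)"] h by auto
  obtain T where T: "T \<in> D h" "R \<subseteq> T" "(?z l R, ?z h T) \<in> ?E ^^ nat (h - l)"
    using vertical_walk[OF D R, of "nat (h - l)"] h by auto
  have "dist (cen h P) (cen k Q) < c2 * \<eta> powi h"
    using dyadic_systemD(4)[OF D Q] dyadic_systemD(5)[OF D P(1)] P(2) by auto
  moreover have "dist (cen h T) (cen l R) < c2 * \<eta> powi h"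
    using dyadic_systemD(4)[OF D R] dyadic_systemD(5)[OF D T(1)] T(2) by auto
  ultimately have "dist (cen h P) (cen h T) < (2 * c2 + 1) * \<eta> powi h"
    using d dist_triangle[of "cen h P" "cen h T" "cen k Q"]
      dist_triangle[of "cen k Q" "cen h T" "cen l R"] dist_commute[of "cen h T" "cen l R"]
    by (simp add: algebra_simps)
  also have "\<dots> < lam * \<eta> powi h"
    using lam pos by simp
  finally have "cen h T \<in> dilated \<eta> lam cen h P \<inter> dilated \<eta> lam cen h T"
    using lam c2 pos unfolding dilated_def by simp
  then have meet: "dilated \<eta> lam cen h P \<inter> dilated \<eta> lam cen h T \<noteq> {}"
    by blast
  have "\<exists>m\<le>1. (?z h P, ?z h T) \<in> ?E ^^ m"
  \<comment> \<open>Splitting on the vertices suffices: at a common level, distinct vertices come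
    from distinct cubes.\<close>
  proof (cases "?z h P = ?z h T")
    case True
    then show ?thesis
      by (intro exI[of _ 0]) simp
  next
    case False
    then have "(?z h P, ?z h T) \<in> ?E"
      unfolding edges_def using P(1) T(1) meet by blast
    then show ?thesis
      by (intro exI[of _ 1]) simp
  qed
  then obtain m where m: "m \<le> 1" "(?z h P, ?z h T) \<in> ?E ^^ m"
    by blast
  have "(?z k Q, ?z l R) \<in> ?E ^^ (nat (h - k) + (m + nat (h - l)))"
    using P(3) m(2) sym_relpow[OF sym_edges T(3)] by (meson relpow_trans)
  then show ?thesis
    using m(1) h by (intro exI[of _ "nat (h - k) + (m + nat (h - l))"]) auto
qed

section \<open>Comparison of the two distances\<close>

text \<open>The squares of the displacement and of both heights are bounded by multiples of
  \<open>snd u * snd v * \<eta> ^ n\<close>. The logarithm to base \<open>\<eta>\<close> turns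
  \<open>\<eta> ^ n\<close> into the length of the walk, and the remaining factor
  \<open>A\<^sup>2 + 2\<close> does not depend on the walk.\<close>

lemma dist_S_le_walk:
  assumes D: "dyadic_system \<mu> \<eta> c1 c2 D cen" and lam: "lam > c2"
  shows "\<exists>C. \<forall>u v n. (u, v) \<in> edges \<eta> lam D cen ^^ n \<longrightarrow> snd u > 0 \<longrightarrow> snd v > 0 \<longrightarrow>
    dist_S (1 / ln \<eta>) u v \<le> real n + C"
proof -
  have eta: "\<eta> > 1" and c2: "c2 > 0"
    by (fact dyadic_systemD[OF D])+
  define K where "K = 2 * lam * \<eta>"
  define B where "B = K / (\<eta> - 1)"
  define A where "A = B + K / (1 - 1 / sqrt \<eta>)"
  have Bpos: "B > 0"
    using eta lam c2 by (simp add: B_def K_def)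
  have A2: "A\<^sup>2 + 2 > 0"
    by (simp add: add_nonneg_pos)
  have "dist_S (1 / ln \<eta>) u v \<le> real n + ln (A\<^sup>2 + 2) / ln \<eta>"
    if walk: "(u, v) \<in> edges \<eta> lam D cen ^^ n" and u: "snd u > 0" and v: "snd v > 0" for u v n
  proof -
    define p where "p = snd u * snd v * \<eta> ^ n"
    have p: "p > 0"
      unfolding p_def using u v eta by simp
    have "dist (fst u) (fst v) \<le> A * sqrt p - B * snd u"
      unfolding p_def using walk_displacement[OF D lam K_def B_def A_def walk v] .
    then have "dist (fst u) (fst v) \<le> A * sqrt p"
      using Bpos u by (smt (verit) mult_pos_pos)
    then have "(dist (fst u) (fst v))\<^sup>2 \<le> (A * sqrt p)\<^sup>2"
      by (rule power_mono) simp
    then have "(dist (fst u) (fst v))\<^sup>2 \<le> A\<^sup>2 * p"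
      using p by (simp add: power_mult_distrib)
    moreover have "(snd u)\<^sup>2 \<le> p" "(snd v)\<^sup>2 \<le> p"
      using walk_height_le[OF D lam walk] u v
      unfolding p_def power2_eq_square
      by (simp_all add: mult.assoc mult.commute mult.left_commute)
    ultimately have "(dist (fst u) (fst v))\<^sup>2 + (snd u)\<^sup>2 + (snd v)\<^sup>2 \<le> (A\<^sup>2 + 2) * p"
      by (simp add: algebra_simps)
    then have "dist_S (1 / ln \<eta>) u v \<le> 1 / ln \<eta> * ln ((A\<^sup>2 + 2) * \<eta> ^ n)"
      using eta u v A2 by (intro dist_S_upper) (auto simp: p_def mult_ac)
    also have "ln ((A\<^sup>2 + 2) * \<eta> ^ n) = ln (A\<^sup>2 + 2) + real n * ln \<eta>"
      using eta A2 by (simp only: ln_mult_pos ln_realpow zero_less_power)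
    also have "1 / ln \<eta> * \<dots> = real n + ln (A\<^sup>2 + 2) / ln \<eta>"
      using eta by (simp add: field_simps)
    finally show ?thesis .
  qed
  then show ?thesis
    by blast
qed

text \<open>The walk over level \<open>h\<close> has at most \<open>2 * h - k - l + 1\<close> edges,
  whereas minimality of \<open>h\<close> bounds \<open>dist_S\<close> below only through
  \<open>2 * (h - 1) - k - l\<close>. The difference is the constant 3;
  \<open>ln 2 / ln \<eta>\<close> is the loss in \<open>dist_S_lower\<close>.\<close>

lemma graph_dist_le_dist_S:
  assumes D: "dyadic_system \<mu> \<eta> c1 c2 D cen" and lam: "lam > 2 * c2 + 1"
    and u: "u \<in> vertices \<eta> D cen" and v: "v \<in> vertices \<eta> D cen"
  shows "real (graph_dist (edges \<eta> lam D cen) u v) \<le> dist_S (1 / ln \<eta>) u v + 3 + ln 2 / ln \<eta>"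
proof -
  have eta: "\<eta> > 1"
    by (fact dyadic_systemD[OF D])
  obtain k Q where Q: "Q \<in> D k" "u = vertex \<eta> cen k Q"
    using u unfolding vertices_def by blast
  obtain l R where R: "R \<in> D l" "v = vertex \<eta> cen l R"
    using v unfolding vertices_def by blast
  define d where "d = dist (cen k Q) (cen l R)"
  define M where "M = max d (max (\<eta> powi k) (\<eta> powi l))"
  \<comment> \<open>Rounding up selects the least level with \<open>M \<le> \<eta> powi h\<close>;
    leastness is what gives \<open>lower\<close>.\<close>
  define h where "h = \<lceil>log \<eta> M\<rceil>"
  have Mpos: "M > 0" and M: "d \<le> M" "\<eta> powi k \<le> M" "\<eta> powi l \<le> M"
    unfolding M_def using eta by (auto simp: less_max_iff_disj)
  have powi: "\<eta> powi j = \<eta> powr real_of_int j" for j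
    using eta by (simp add: powr_real_of_int')
  have upper: "M \<le> \<eta> powi h"
    unfolding powi h_def using eta Mpos by (subst log_le_iff[symmetric]) auto
  have "\<eta> powr (real_of_int h - 1) < M"
    using eta Mpos unfolding h_def by (subst less_log_iff[symmetric]) linarith+
  then have lower: "\<eta> powi (h - 1) < M"
    unfolding powi by simp
  have "real_of_int k \<le> log \<eta> M" "real_of_int l \<le> log \<eta> M"
    using M eta Mpos unfolding powi by (simp_all add: le_log_iff)
  then have "k \<le> h" "l \<le> h"
    unfolding h_def by linarith+
  moreover have "dist (cen k Q) (cen l R) \<le> \<eta> powi h"
    using upper M(1) unfolding d_def by linarith
  ultimately obtain n where n: "int n \<le> 2 * h - k - l + 1" "(u, v) \<in> edges \<eta> lam D cen ^^ n"
    using walk_over_top[OF D lam Q(1) R(1)] unfolding Q(2) R(2) by blast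
  have "graph_dist (edges \<eta> lam D cen) u v \<le> n"
    unfolding graph_dist_def using n(2) by (rule Least_le)
  then have g: "int (graph_dist (edges \<eta> lam D cen) u v) \<le> 2 * h - k - l + 1"
    using n(1) by linarith
  have "\<eta> powi (2 * (h - 1) - k - l) * (\<eta> powi k * \<eta> powi l) = (\<eta> powi (h - 1))\<^sup>2"
    using eta by (simp add: power_int_add[symmetric] power2_eq_square)
  also have "\<dots> \<le> M\<^sup>2"
    using lower eta by (intro power_mono) auto
  \<comment> \<open>\<open>M\<close> is one of the three numbers squared on the right.\<close>
  also have "\<dots> \<le> d\<^sup>2 + (\<eta> powi k)\<^sup>2 + (\<eta> powi l)\<^sup>2"
    unfolding M_def max_def by auto
  finally have "1 / ln \<eta> * (ln (\<eta> powi (2 * (h - 1) - k - l)) - ln 2) \<le> dist_S (1 / ln \<eta>) u v"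
    using eta unfolding d_def by (intro dist_S_lower) (simp_all add: Q(2) R(2) vertex_def)
  moreover have "1 / ln \<eta> * (ln (\<eta> powi (2 * (h - 1) - k - l)) - ln 2)
      = real_of_int (2 * (h - 1) - k - l) - ln 2 / ln \<eta>"
    using eta unfolding powi by (simp add: ln_powr field_simps)
  ultimately have "real_of_int (2 * (h - 1) - k - l) - ln 2 / ln \<eta> \<le> dist_S (1 / ln \<eta>) u v"
    by (simp only:)
  moreover have "real (graph_dist (edges \<eta> lam D cen) u v) \<le> real_of_int (2 * (h - 1) - k - l) + 3"
    using of_int_le_iff[where 'a = real, THEN iffD2, OF g] by simp
  ultimately show ?thesis
    by linarith
qed

section \<open>Coarse density of the vertices\<close>

text \<open>At the scale obtained by rounding \<open>log \<eta> (snd x)\<close> down, the cube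
  containing \<open>fst x\<close> works: its centre is within \<open>c2\<close> times its height,
  and the two heights differ by a factor of at most \<open>\<eta>\<close>.\<close>

lemma dist_S_vertices_bounded:
  fixes cen :: "int \<Rightarrow> 'a::metric_space set \<Rightarrow> 'a"
  assumes D: "dyadic_system \<mu> \<eta> c1 c2 D cen" and x: "x \<in> upper_space"
  shows "\<exists>v\<in>vertices \<eta> D cen. dist_S (1 / ln \<eta>) x v \<le> 1 / ln \<eta> * ln (c2\<^sup>2 + \<eta>\<^sup>2 + 1)"
proof -
  have eta: "\<eta> > 1"
    by (fact dyadic_systemD[OF D])
  have t: "snd x > 0"
    using x by (auto simp: upper_space_def)
  define k where "k = \<lfloor>log \<eta> (snd x)\<rfloor>"
  obtain Q where Q: "Q \<in> D k" "fst x \<in> Q"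
    using dyadic_systemD(3)[OF D, of k] unfolding partition_on_def by blast
  define y where "y = \<eta> powi k"
  have powr: "y = \<eta> powr real_of_int k"
    using eta unfolding y_def by (simp add: powr_real_of_int')
  have y: "y > 0"
    using eta by (simp add: y_def)
  have ly: "y \<le> snd x"
    unfolding powr k_def using eta t by (subst le_log_iff[symmetric]) auto
  have "snd x < \<eta> powr (real_of_int k + 1)"
    unfolding k_def using eta t by (subst log_less_iff[symmetric]) auto
  then have uy: "snd x \<le> \<eta> * y"
    using eta unfolding powr by (simp add: powr_add mult.commute)
  have "dist (fst x) (cen k Q) \<le> c2 * y"
    using dyadic_systemD(5)[OF D Q] unfolding y_def by (simp add: dist_commute)
  then have "(dist (fst x) (cen k Q))\<^sup>2 \<le> (c2 * y)\<^sup>2"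
    by (rule power_mono) simp
  moreover have "(snd x)\<^sup>2 \<le> (\<eta> * y)\<^sup>2"
    using uy t by (intro power_mono) auto
  ultimately have "(dist (fst x) (cen k Q))\<^sup>2 + (snd x)\<^sup>2 + y\<^sup>2 \<le> (c2\<^sup>2 + \<eta>\<^sup>2 + 1) * (y * y)"
    by (simp add: power_mult_distrib algebra_simps power2_eq_square)
  \<comment> \<open>One factor \<open>y\<close> is traded for the larger \<open>snd x\<close> to
    reach the product of heights required by \<open>dist_S_upper\<close>.\<close>
  also have "\<dots> \<le> (c2\<^sup>2 + \<eta>\<^sup>2 + 1) * (snd x * y)"
    using ly y by (intro mult_left_mono) auto
  finally have "dist_S (1 / ln \<eta>) x (vertex \<eta> cen k Q) \<le> 1 / ln \<eta> * ln (c2\<^sup>2 + \<eta>\<^sup>2 + 1)"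
    using eta t y by (intro dist_S_upper) (simp_all add: vertex_def y_def add_nonneg_pos)
  then show ?thesis
    using Q(1) unfolding vertices_def by blast
qed

text \<open>By \<open>height_vertex\<close> the height recovered from a vertex is the scale of its
  cube, which restores the second coordinate.\<close>

lemma embedding_vertex:
  assumes "\<eta> > 1" "v \<in> vertices \<eta> D cen"
  shows "embedding \<eta> D cen v = v"
  using assms by (auto simp: vertices_def embedding_def height_vertex) (simp add: vertex_def)

theorem theorem3p13:
  fixes \<mu> :: "'a::metric_space measure"
    and D :: "int \<Rightarrow> 'a set set"
    and cen :: "int \<Rightarrow> 'a set \<Rightarrow> 'a"
    and \<eta> c1 c2 lam :: real
  assumes "geodesic_space TYPE('a)"
    and "doubling_measure \<mu>"
    and "dyadic_system \<mu> \<eta> c1 c2 D cen"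
    and "lam > max (\<eta> / (\<eta> - 1) * c2) (2 * c2 + 1)"
  shows "\<exists>C>0.
    (\<forall>u\<in>vertices \<eta> D cen. \<forall>v\<in>vertices \<eta> D cen.
       \<bar>dist_S (1 / ln \<eta>) (embedding \<eta> D cen u) (embedding \<eta> D cen v)
          - real (graph_dist (edges \<eta> lam D cen) u v)\<bar> \<le> C) \<and>
    (SUP x\<in>upper_space. INF v\<in>vertices \<eta> D cen.
       ereal (dist_S (1 / ln \<eta>) x (embedding \<eta> D cen v))) < \<infinity>"
proof -
  note D = assms(3)
  have eta: "\<eta> > 1" and c2: "c2 > 0"
    by (fact dyadic_systemD[OF D])+
  have lam: "lam > 2 * c2 + 1" "lam > c2"
    using assms(4) c2 by auto
  let ?E = "edges \<eta> lam D cen"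
  obtain C1 where C1: "\<And>u v n. (u, v) \<in> ?E ^^ n \<Longrightarrow> snd u > 0 \<Longrightarrow> snd v > 0 \<Longrightarrow>
      dist_S (1 / ln \<eta>) u v \<le> real n + C1"
    using dist_S_le_walk[OF D lam(2)] by metis
  \<comment> \<open>One constant serves both inequalities; the second entry ensures positivity, as
    the sign of \<open>C1\<close> is not recorded.\<close>
  define C where "C = max C1 (3 + ln 2 / ln \<eta>)"
  have "3 + ln 2 / ln \<eta> > 0"
    using eta by (simp add: add_pos_nonneg)
  then have "C > 0"
    unfolding C_def by linarith
  have bound: "\<bar>dist_S (1 / ln \<eta>) (embedding \<eta> D cen u) (embedding \<eta> D cen v)
      - real (graph_dist ?E u v)\<bar> \<le> C"
    if u: "u \<in> vertices \<eta> D cen" and v: "v \<in> vertices \<eta> D cen" for u v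
  proof -
    have pos: "snd u > 0" "snd v > 0"
      using u v eta by (auto simp: vertices_def vertex_def)
    \<comment> \<open>Connectedness ensures that the \<open>LEAST\<close> in
      \<open>graph_dist\<close> is attained by an actual walk.\<close>
    have "\<exists>n. (u, v) \<in> ?E ^^ n"
      using connected_graph[OF D lam(1) u v] by (rule rtrancl_imp_relpow)
    then have "(u, v) \<in> ?E ^^ graph_dist ?E u v"
      unfolding graph_dist_def by (rule LeastI_ex)
    then have "dist_S (1 / ln \<eta>) u v \<le> real (graph_dist ?E u v) + C1"
      using pos by (rule C1)
    then show ?thesis
      using graph_dist_le_dist_S[OF D lam(1) u v]
      unfolding embedding_vertex[OF eta u] embedding_vertex[OF eta v] C_def by linarith
  qed
  \<comment> \<open>A single nearby vertex bounds each infimum, and the bound is independent of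
    \<open>x\<close>, so it passes to the supremum.\<close>
  have "(SUP x\<in>upper_space. INF v\<in>vertices \<eta> D cen.
      ereal (dist_S (1 / ln \<eta>) x (embedding \<eta> D cen v)))
      \<le> ereal (1 / ln \<eta> * ln (c2\<^sup>2 + \<eta>\<^sup>2 + 1))"
  proof (rule SUP_least)
    fix x :: "'a \<times> real" assume "x \<in> upper_space"
    then obtain v where v: "v \<in> vertices \<eta> D cen"
      "dist_S (1 / ln \<eta>) x v \<le> 1 / ln \<eta> * ln (c2\<^sup>2 + \<eta>\<^sup>2 + 1)"
      using dist_S_vertices_bounded[OF D] by blast
    show "(INF v\<in>vertices \<eta> D cen. ereal (dist_S (1 / ln \<eta>) x (embedding \<eta> D cen v)))
      \<le> ereal (1 / ln \<eta> * ln (c2\<^sup>2 + \<eta>\<^sup>2 + 1))"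
      using v by (intro INF_lower2[OF v(1)]) (simp add: embedding_vertex[OF eta v(1)])
  qed
  then have sup: "(SUP x\<in>upper_space. INF v\<in>vertices \<eta> D cen.
      ereal (dist_S (1 / ln \<eta>) x (embedding \<eta> D cen v))) < \<infinity>"
    by (rule le_less_trans) simp
  show ?thesis
    by (intro exI[of _ C] conjI ballI bound sup \<open>C > 0\<close>)
qed

end
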